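(* Let $G=(V,E)$ be a finite, undirected, loopless multi-graph and let $u\in V$. Then $$\tau(G)=\prod_{v\in V\setminus\{u\}}d_G(v)-\sum_{T\in \mathrm{NST}_u(G)}\ \prod_{v\in V\setminus V(T)}d_{G-V(T)}(v).$$
   Context: $\tau(G)$ denotes the number of spanning trees of $G$ (spanning trees are counted as edge sets, so trees using different parallel edges are distinct). $d_G(v)$ is the degree of $v$ in $G$, i.e. the number of edges of $G$ incident with $v$. $\mathrm{NST}_u(G)$ is the set of non-spanning subtrees of $G$ containing $u$, i.e. subgraphs $T$ of $G$ that are trees, with $u\in V(T)$ and $V(T)\neq V$ (this includes the single-vertex tree $\{u\}$; trees differing in the choice of parallel edges are distinct). For $S\subsetneq V$, $G-S$ denotes the subgraph of $G$ induced by $V\setminus S$, and $d_{G-V(T)}(v)$ is the degree of $v$ in $G-V(T)$. An empty product equals $1$. *)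

theory Defs
  imports Main
begin

text \<open>
  Edges are elements of a type of their own and are mapped to their sets of end vertices,
  so parallel edges are distinct edges with the same ends.
\<close>

record ('v, 'e) mgraph =
  verts :: "'v set"
  edges :: "'e set"
  ends  :: "'e \<Rightarrow> 'v set"

text \<open>Looplessness is the requirement that every edge has two different ends.\<close>

locale multigraph =
  fixes G :: "('v, 'e) mgraph"
  assumes finite_verts: "finite (verts G)"
    and finite_edges: "finite (edges G)"
    and ends_in_verts: "e \<in> edges G \<Longrightarrow> ends G e \<subseteq> verts G"
    and loopless: "e \<in> edges G \<Longrightarrow> card (ends G e) = 2"

definition graph_degree :: "('v, 'e) mgraph \<Rightarrow> 'v \<Rightarrow> nat" where
  "graph_degree G v = card {e \<in> edges G. v \<in> ends G e}"

text \<open>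
  A subgraph carries the same incidence function as the whole graph, also outside its own
  edge set; hence it is determined by its vertices and edges.
\<close>

definition is_subgraph :: "('v, 'e) mgraph \<Rightarrow> ('v, 'e) mgraph \<Rightarrow> bool" where
  "is_subgraph H G \<longleftrightarrow>
     verts H \<subseteq> verts G \<and> edges H \<subseteq> edges G \<and> ends H = ends G \<and> multigraph H"

definition delete_verts :: "('v, 'e) mgraph \<Rightarrow> 'v set \<Rightarrow> ('v, 'e) mgraph" where
  "delete_verts G S =
     G\<lparr>verts := verts G - S, edges := {e \<in> edges G. ends G e \<subseteq> verts G - S}\<rparr>"

fun is_walk :: "('v, 'e) mgraph \<Rightarrow> 'v \<Rightarrow> 'e list \<Rightarrow> 'v \<Rightarrow> bool" where
  "is_walk G x [] y \<longleftrightarrow> x \<in> verts G \<and> x = y"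
| "is_walk G x (e # es) y \<longleftrightarrow>
     e \<in> edges G \<and> (\<exists>z. ends G e = {x, z} \<and> is_walk G z es y)"

definition graph_connected :: "('v, 'e) mgraph \<Rightarrow> bool" where
  "graph_connected G \<longleftrightarrow>
     verts G \<noteq> {} \<and> (\<forall>x\<in>verts G. \<forall>y\<in>verts G. \<exists>es. is_walk G x es y)"

text \<open>
  The edge at position \<open>i\<close> joins the vertices at positions \<open>i\<close> and \<open>i + 1\<close>, cyclically.
  Two parallel edges form a cycle of length 2; distinctness of the edges prevents
  a single edge, traversed back and forth, from being one.
\<close>

definition is_cycle :: "('v, 'e) mgraph \<Rightarrow> 'v list \<Rightarrow> 'e list \<Rightarrow> bool" where
  "is_cycle G xs es \<longleftrightarrow>
     es \<noteq> [] \<and> length xs = length es \<and> distinct xs \<and> distinct es \<and>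
     set xs \<subseteq> verts G \<and> set es \<subseteq> edges G \<and>
     (\<forall>i<length es. ends G (es ! i) = {xs ! i, xs ! (Suc i mod length es)})"

definition is_tree :: "('v, 'e) mgraph \<Rightarrow> bool" where
  "is_tree G \<longleftrightarrow> multigraph G \<and> graph_connected G \<and> (\<nexists>xs es. is_cycle G xs es)"

definition spanning_trees :: "('v, 'e) mgraph \<Rightarrow> 'e set set" where
  "spanning_trees G = {F. F \<subseteq> edges G \<and> is_tree (G\<lparr>edges := F\<rparr>)}"

definition num_spanning_trees :: "('v, 'e) mgraph \<Rightarrow> nat" where
  "num_spanning_trees G = card (spanning_trees G)"

definition NST :: "('v, 'e) mgraph \<Rightarrow> 'v \<Rightarrow> ('v, 'e) mgraph set" where
  "NST G u = {T. is_subgraph T G \<and> is_tree T \<and> u \<in> verts T \<and> verts T \<noteq> verts G}"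

lemma (in multigraph) finite_spanning_trees: "finite (spanning_trees G)"
  unfolding spanning_trees_def using finite_edges by simp

lemma (in multigraph) finite_NST: "finite (NST G u)"
proof (rule finite_subset)
  show "NST G u \<subseteq>
    (\<lambda>(W, F). \<lparr>verts = W, edges = F, ends = ends G\<rparr>) ` (Pow (verts G) \<times> Pow (edges G))"
  proof
    fix T assume "T \<in> NST G u"
    then have "verts T \<subseteq> verts G" "edges T \<subseteq> edges G" "ends T = ends G"
      by (auto simp: NST_def is_subgraph_def)
    then show "T \<in> (\<lambda>(W, F). \<lparr>verts = W, edges = F, ends = ends G\<rparr>) `
        (Pow (verts G) \<times> Pow (edges G))"
      by (intro image_eqI[of _ _ "(verts T, edges T)"]) auto
  qed
qed (simp add: finite_verts finite_edges)

end

theory Submission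
  imports Defs "HOL-Library.FuncSet"
begin

text \<open>
  The product of the degrees counts the functions \<open>f\<close> that choose for every vertex
  \<open>v \<noteq> u\<close> an edge at \<open>v\<close>. Following the chosen edges, the vertices from which one arrives
  at \<open>u\<close>, together with their chosen edges, form a tree \<open>T\<close> containing \<open>u\<close>, and every other
  vertex chooses an edge avoiding \<open>T\<close>. Conversely, a tree has exactly one orientation towards
  \<open>u\<close>, so the functions that yield a given \<open>T\<close> correspond to the choice functions of
  \<open>G - V(T)\<close>. The spanning trees contribute 1 each.
\<close>

section \<open>Orientations towards a root\<close>

text \<open>Following \<open>f\<close> may run into a cycle and never reach \<open>u\<close>, so the
  number of steps to \<open>u\<close> is a relation, not a function. It refers to an incidence
  function rather than a graph because a graph and its subgraphs share that function. Paths stop at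
  \<open>u\<close>, which makes depths unique.\<close>

inductive depth :: "('e \<Rightarrow> 'v set) \<Rightarrow> ('v \<Rightarrow> 'e) \<Rightarrow> 'v \<Rightarrow> 'v \<Rightarrow> nat \<Rightarrow> bool"
  for en f u where
  root: "depth en f u u 0"
| step: "v \<noteq> u \<Longrightarrow> en (f v) = {v, w} \<Longrightarrow> depth en f u w n \<Longrightarrow> depth en f u v (Suc n)"

lemma depth_unique:
  assumes "depth en f u v m" and "depth en f u v n"
  shows "m = n"
  using assms
proof (induction arbitrary: n rule: depth.induct)
  case root
  then show ?case by (auto elim: depth.cases)
next
  case (step v w m)
  from step.prems show ?case
  proof cases
    case root
    then show ?thesis using step.hyps by simp
  next
    case (step w' k)
    then have "w' = w" using \<open>en (f v) = {v, w}\<close> by (auto simp: doubleton_eq_iff)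
    then show ?thesis using step step.IH by simp
  qed
qed

lemma depth_parent:
  assumes "depth en f u v n" and "v \<noteq> u" and "en (f v) = {v, w}"
  obtains m where "n = Suc m" and "depth en f u w m"
  using assms(1)
proof cases
  case root
  then show ?thesis using assms by simp
next
  case (step w' k)
  then have "w' = w" using assms(3) by (auto simp: doubleton_eq_iff)
  then show ?thesis using step that by blast
qed

text \<open>The path from \<open>v\<close> to \<open>u\<close> stays in \<open>W\<close>, where
  \<open>f\<close> and \<open>g\<close> agree. This carries depths from an orientation of a subtree
  over to a choice function on the whole graph.\<close>

lemma depth_cong:
  assumes "depth en f u v n" and "v \<in> W"
    and "\<And>x. x \<in> W - {u} \<Longrightarrow> f x = g x"
    and "\<And>x y. x \<in> W - {u} \<Longrightarrow> en (f x) = {x, y} \<Longrightarrow> y \<in> W"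
  shows "depth en g u v n"
  using assms(1,2)
proof (induction rule: depth.induct)
  case root
  show ?case by (rule depth.root)
next
  case (step v w n)
  then have "f v = g v" "w \<in> W" using assms(3)[of v] assms(4)[of v w] by auto
  then show ?case using step by (metis depth.step)
qed

text \<open>The parent edges of a spanning tree directed towards \<open>u\<close>. Edges of
  \<open>T\<close> that no vertex chooses are allowed, so every connected graph has such a
  \<open>p\<close>; where all edges must be chosen, this is stated separately.\<close>

definition arborescence :: "('v, 'e) mgraph \<Rightarrow> 'v \<Rightarrow> ('v \<Rightarrow> 'e) \<Rightarrow> bool" where
  "arborescence T u p \<longleftrightarrow> u \<in> verts T \<and>
     (\<forall>v\<in>verts T - {u}. p v \<in> edges T \<and> v \<in> ends T (p v)) \<and>
     (\<forall>v\<in>verts T. \<exists>n. depth (ends T) p u v n)"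

lemma (in multigraph) other_end:
  assumes "e \<in> edges G" and "v \<in> ends G e"
  obtains w where "ends G e = {v, w}" and "w \<noteq> v" and "w \<in> verts G"
proof -
  obtain a b where ab: "ends G e = {a, b}" "a \<noteq> b"
    using loopless[OF assms(1)] by (auto simp: card_2_iff)
  then have "a \<in> verts G" "b \<in> verts G" using ends_in_verts[OF assms(1)] by auto
  then show ?thesis using ab assms(2) that[of a] that[of b] by auto
qed

lemma (in multigraph) arborescence_parent:
  assumes "arborescence G u p" and "v \<in> verts G - {u}"
  obtains w m where "p v \<in> edges G" "ends G (p v) = {v, w}" "w \<noteq> v" "w \<in> verts G"
    "depth (ends G) p u v (Suc m)" "depth (ends G) p u w m"
proof -
  have e: "p v \<in> edges G" "v \<in> ends G (p v)"
    using assms by (auto simp: arborescence_def)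
  obtain w where w: "ends G (p v) = {v, w}" "w \<noteq> v" "w \<in> verts G"
    using other_end[OF e] by blast
  obtain n where n: "depth (ends G) p u v n" using assms by (auto simp: arborescence_def)
  obtain m where "n = Suc m" "depth (ends G) p u w m"
    using depth_parent[OF n _ w(1)] assms(2) by auto
  then show ?thesis using that e w n by blast
qed

text \<open>Two vertices choosing the same edge would be each other's parents, so each would be
  deeper than the other.\<close>

lemma (in multigraph) arborescence_inj_on:
  assumes "arborescence G u p"
  shows "inj_on p (verts G - {u})"
proof (rule inj_onI, rule ccontr)
  fix v v' assume v: "v \<in> verts G - {u}" and v': "v' \<in> verts G - {u}"
    and eq: "p v = p v'" and ne: "v \<noteq> v'"
  obtain w m where w: "ends G (p v) = {v, w}"
    "depth (ends G) p u v (Suc m)" "depth (ends G) p u w m"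
    using arborescence_parent[OF assms v] by metis
  obtain w' m' where w': "ends G (p v') = {v', w'}"
    "depth (ends G) p u v' (Suc m')" "depth (ends G) p u w' m'"
    using arborescence_parent[OF assms v'] by metis
  have "w = v'" "w' = v" using w(1) w'(1) eq ne by (auto simp: doubleton_eq_iff)
  then have "m = Suc m'" "m' = Suc m" using w w' depth_unique by metis+
  then show False by simp
qed

section \<open>Oriented graphs are trees\<close>

lemma is_walk_append:
  assumes "is_walk G x es y" and "is_walk G y es' z"
  shows "is_walk G x (es @ es') z"
  using assms(1)
proof (induction es arbitrary: x)
  case Nil
  then show ?case using assms(2) by simp
next
  case (Cons e es)
  then show ?case by (metis append_Cons is_walk.simps(2))
qed

lemma (in multigraph) is_walk_rev:
  assumes "is_walk G x es y"
  shows "is_walk G y (rev es) x"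
  using assms
proof (induction es arbitrary: x)
  case Nil
  then show ?case by auto
next
  case (Cons e es)
  then obtain z where e: "e \<in> edges G" and z: "ends G e = {x, z}" "is_walk G z es y" by auto
  have "x \<in> verts G" using ends_in_verts[OF e] z by auto
  then have "is_walk G z [e] x" using e z by (auto simp: insert_commute)
  then show ?case using is_walk_append[OF Cons.IH[OF z(2)]] by simp
qed

lemma (in multigraph) arborescence_connected:
  assumes "arborescence G u p"
  shows "graph_connected G"
proof -
  have to_root: "\<exists>es. is_walk G v es u" if "depth (ends G) p u v n" "v \<in> verts G" for v n
    using that
  proof (induction rule: depth.induct)
    case root
    then have "is_walk G u [] u" by simp
    then show ?case by blast
  next
    case (step v w n)
    then have e: "p v \<in> edges G" using assms by (auto simp: arborescence_def)
    then have "w \<in> verts G" using ends_in_verts step.hyps by blast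
    then obtain es where "is_walk G w es u" using step.IH by blast
    then have "is_walk G v (p v # es) u" using e step.hyps by auto
    then show ?case by blast
  qed
  have "\<exists>es. is_walk G x es y" if x: "x \<in> verts G" and y: "y \<in> verts G" for x y
  proof -
    obtain es es' where "is_walk G x es u" "is_walk G y es' u"
      using to_root x y assms unfolding arborescence_def by metis
    then have "is_walk G x (es @ rev es') y" by (intro is_walk_append is_walk_rev)
    then show ?thesis by blast
  qed
  then show ?thesis using assms by (auto simp: graph_connected_def arborescence_def)
qed

text \<open>A deepest vertex of a cycle would have chosen both of its cycle edges.\<close>

lemma (in multigraph) arborescence_is_tree:
  assumes arb: "arborescence G u p" and onto: "edges G = p ` (verts G - {u})"
  shows "is_tree G"
proof -
  have False if cyc: "is_cycle G xs es" for xs es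
  proof -
    define k where "k = length es"
    have k: "k > 0" "length xs = k" "length es = k" "distinct es" "set xs \<subseteq> verts G"
      and edge: "\<And>i. i < k \<Longrightarrow> es ! i \<in> edges G"
      and en: "\<And>i. i < k \<Longrightarrow> ends G (es ! i) = {xs ! i, xs ! (Suc i mod k)}"
      using cyc by (auto simp: is_cycle_def k_def)
    have "k \<noteq> 1" using edge[of 0] en[of 0] loopless[of "es ! 0"] by auto
    then have k2: "k \<ge> 2" using k by simp
    define d where "d v = (THE n. depth (ends G) p u v n)" for v
    have d: "depth (ends G) p u v n \<Longrightarrow> d v = n" for v n
      unfolding d_def by (blast intro: depth_unique)
    have "finite (d ` set xs)" "d ` set xs \<noteq> {}" using k by auto
    then obtain x where x: "x \<in> set xs" "d x = Max (d ` set xs)" by (metis Max_in imageE)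
    have max: "d y \<le> d x" if "y \<in> set xs" for y using x(2) that by simp
    \<comment> \<open>The vertex that chose \<open>e\<close> is one step deeper than the other end
      of \<open>e\<close>. As \<open>y\<close> is no deeper than \<open>x\<close>, that vertex is
      \<open>x\<close>.\<close>
    have chosen: "e = p x" if e: "e \<in> edges G" "ends G e = {x, y}" "y \<in> set xs" for e y
    proof -
      obtain v where v: "v \<in> verts G - {u}" "e = p v" using e onto by auto
      obtain w m where w: "ends G (p v) = {v, w}" "w \<noteq> v"
        "depth (ends G) p u v (Suc m)" "depth (ends G) p u w m"
        using arborescence_parent[OF arb v(1)] by metis
      have "d w < d v" using d w by simp
      then have "v = x" using max[OF e(3)] e(2) v(2) w by (auto simp: doubleton_eq_iff)
      then show ?thesis using v by simp
    qed
    obtain i where i: "i < k" "xs ! i = x" using x k by (metis in_set_conv_nth)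
    \<comment> \<open>The cyclic predecessor of \<open>i\<close>; it differs from \<open>i\<close>
      because the cycle has length at least 2.\<close>
    define j where "j = (if i = 0 then k - 1 else i - 1)"
    have j: "j < k" "Suc j mod k = i" "j \<noteq> i" using i k2 by (auto simp: j_def)
    have "es ! i = p x"
      using chosen[OF edge[OF i(1)], of "xs ! (Suc i mod k)"] en[OF i(1)] i k by auto
    moreover have "es ! j = p x"
      using chosen[OF edge[OF j(1)], of "xs ! j"] en[OF j(1)] i j k by (auto simp: insert_commute)
    ultimately show False using nth_eq_iff_index_eq[OF k(4)] i j k by metis
  qed
  then show ?thesis using arborescence_connected[OF arb] multigraph_axioms
    by (auto simp: is_tree_def)
qed

section \<open>A tree has exactly one orientation towards a given root\<close>

text \<open>Every vertex chooses the first edge of a shortest walk to the root.\<close>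

lemma (in multigraph) arborescence_exists:
  assumes "graph_connected G" and u: "u \<in> verts G"
  shows "\<exists>p. arborescence G u p"
proof -
  define d where "d v = (LEAST n. \<exists>es. is_walk G v es u \<and> length es = n)" for v
  have le: "d v \<le> length es" if "is_walk G v es u" for v es
    unfolding d_def by (rule Least_le) (use that in blast)
  have "\<exists>e w. e \<in> edges G \<and> ends G e = {v, w} \<and> w \<in> verts G \<and> d w < d v"
    if v: "v \<in> verts G - {u}" for v
  proof -
    have "\<exists>n es. is_walk G v es u \<and> length es = n"
      using assms v by (auto simp: graph_connected_def)
    from LeastI_ex[OF this] obtain es where es: "is_walk G v es u" "length es = d v"
      unfolding d_def by blast
    then obtain e es' where "es = e # es'" using v by (cases es) auto
    then obtain w where w: "e \<in> edges G" "ends G e = {v, w}" "is_walk G w es' u"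
      "Suc (length es') = d v" using es by auto
    then show ?thesis using le[OF w(3)] ends_in_verts[OF w(1)]
      by (intro exI[of _ e] exI[of _ w]) auto
  qed
  then obtain p w where p: "\<And>v. v \<in> verts G - {u} \<Longrightarrow> p v \<in> edges G \<and>
      ends G (p v) = {v, w v} \<and> w v \<in> verts G \<and> d (w v) < d v" by metis
  have "\<exists>n. depth (ends G) p u v n" if "v \<in> verts G" for v
    using that
  proof (induction "d v" arbitrary: v rule: less_induct)
    case less
    show ?case
    proof (cases "v = u")
      case True
      then show ?thesis using depth.root by metis
    next
      case False
      then have pv: "ends G (p v) = {v, w v}" "w v \<in> verts G" "d (w v) < d v"
        using p[of v] less.prems by auto
      then show ?thesis using less.hyps False depth.step by metis
    qed
  qed
  then have "arborescence G u p" using p u by (auto simp: arborescence_def)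
  then show ?thesis by blast
qed

text \<open>Following an injective choice of edges in a finite graph must eventually close a cycle.\<close>

lemma (in multigraph) is_cycle_if_inj_choice:
  assumes ne: "verts G \<noteq> {}" and inj: "inj_on f (verts G)"
    and f: "\<And>v. v \<in> verts G \<Longrightarrow> f v \<in> edges G \<and> v \<in> ends G (f v)"
  shows "\<exists>xs es. is_cycle G xs es"
proof -
  have "\<exists>w. ends G (f v) = {v, w} \<and> w \<in> verts G" if "v \<in> verts G" for v
    using other_end[of "f v" v] f[OF that] by metis
  then obtain s where s: "\<And>v. v \<in> verts G \<Longrightarrow> ends G (f v) = {v, s v} \<and> s v \<in> verts G"
    by metis
  obtain v where v: "v \<in> verts G" using ne by blast
  have iter: "(s ^^ i) x \<in> verts G" if "x \<in> verts G" for i x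
    using that s by (induction i) auto
  \<comment> \<open>The orbit of \<open>v\<close> under \<open>s\<close> repeats by finiteness, so
    it contains a vertex \<open>z\<close> to which iteration returns. The least return time
    \<open>k\<close> gives the length of the cycle.\<close>
  have "\<not> inj_on (\<lambda>i. (s ^^ i) v) UNIV"
    using finite_subset[OF _ finite_verts, of "range (\<lambda>i. (s ^^ i) v)"] iter[OF v]
    by (meson finite_imageD image_subsetI infinite_UNIV_nat)
  then obtain i j where ij: "i < j" "(s ^^ i) v = (s ^^ j) v"
    unfolding inj_on_def by (metis linorder_neqE_nat)
  define z where "z = (s ^^ i) v"
  have z: "z \<in> verts G" using iter v by (simp add: z_def)
  have "(s ^^ (j - i)) z = z"
    using ij unfolding z_def by (metis add.commute comp_apply funpow_add le_add_diff_inverse less_imp_le)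
  then have ex: "\<exists>k. k > 0 \<and> (s ^^ k) z = z" using ij by (metis zero_less_diff)
  define k where "k = (LEAST k. k > 0 \<and> (s ^^ k) z = z)"
  have k: "k > 0" "(s ^^ k) z = z" using LeastI_ex[OF ex] by (auto simp: k_def)
  have least: "k \<le> m" if "m > 0" "(s ^^ m) z = z" for m
    unfolding k_def by (rule Least_le) (use that in blast)
  have ne_iter: "(s ^^ a) z \<noteq> (s ^^ b) z" if "a < b" "b < k" for a b
  proof
    assume eq: "(s ^^ a) z = (s ^^ b) z"
    \<comment> \<open>Another \<open>k - b\<close> iterations turn the right-hand side into
      \<open>z\<close>, so \<open>z\<close> would return after \<open>k - b + a\<close> steps, which
      is positive but less than \<open>k\<close>.\<close>
    have "(s ^^ (k - b + a)) z = (s ^^ (k - b + b)) z"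
      using eq by (simp only: funpow_add comp_apply)
    then have "(s ^^ (k - b + a)) z = z" using that k by simp
    then show False using least[of "k - b + a"] that by simp
  qed
  define xs where "xs = map (\<lambda>i. (s ^^ i) z) [0..<k]"
  have xs: "length xs = k" "\<And>i. i < k \<Longrightarrow> xs ! i = (s ^^ i) z" "set xs \<subseteq> verts G"
    using iter z by (auto simp: xs_def)
  have dist: "distinct xs"
    unfolding distinct_conv_nth using xs ne_iter by (metis linorder_neqE_nat)
  have "ends G (map f xs ! i) = {xs ! i, xs ! (Suc i mod k)}" if i: "i < k" for i
  proof -
    have "s (xs ! i) = (s ^^ Suc i) z" using xs i by simp
    also have "\<dots> = xs ! (Suc i mod k)"
      using i k xs by (cases "Suc i = k") auto
    finally show ?thesis using s[of "xs ! i"] xs i iter z by auto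
  qed
  \<comment> \<open>Injectivity matters when \<open>k = 2\<close>: it keeps the two vertices from
    choosing one and the same edge.\<close>
  moreover have "distinct (map f xs)"
    using dist xs(3) inj by (simp add: distinct_map inj_on_subset)
  ultimately have "is_cycle G xs (map f xs)"
    using k xs dist f by (auto simp: is_cycle_def)
  then show ?thesis by blast
qed

text \<open>
  If an edge \<open>e\<close> at \<open>x\<close> were not chosen, the graph without \<open>e\<close> would still be connected, so it
  could be oriented towards \<open>x\<close>; letting \<open>x\<close> choose \<open>e\<close> then gives a cycle.
\<close>

lemma (in multigraph) arborescence_onto:
  assumes tree: "is_tree G" and arb: "arborescence G u p"
  shows "edges G = p ` (verts G - {u})"
proof (rule ccontr)
  assume "edges G \<noteq> p ` (verts G - {u})"
  then obtain e where e: "e \<in> edges G" "e \<notin> p ` (verts G - {u})"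
    using arb by (auto simp: arborescence_def)
  define H where "H = G\<lparr>edges := edges G - {e}\<rparr>"
  interpret H: multigraph H
    using finite_verts finite_edges ends_in_verts loopless
    by unfold_locales (auto simp: H_def)
  have "arborescence H u p" using arb e by (auto simp: arborescence_def H_def)
  then have "graph_connected H" by (rule H.arborescence_connected)
  obtain x where x: "x \<in> ends G e" using loopless[OF e(1)] by fastforce
  then have xV: "x \<in> verts G" using ends_in_verts e by blast
  then obtain q where q: "arborescence H x q"
    using H.arborescence_exists[OF \<open>graph_connected H\<close>, of x] by (auto simp: H_def)
  have qe: "q v \<in> edges G - {e} \<and> v \<in> ends G (q v)" if "v \<in> verts G - {x}" for v
    using q that by (auto simp: arborescence_def H_def)
  have "inj_on q (verts G - {x})" using H.arborescence_inj_on[OF q] by (simp add: H_def)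
  \<comment> \<open>Away from \<open>x\<close>, \<open>q\<close> takes only edges other than
    \<open>e\<close>, so the root can be given \<open>e\<close> without losing injectivity.\<close>
  then have "inj_on (q(x := e)) (verts G)"
    using qe by (fastforce simp: inj_on_def)
  moreover have "(q(x := e)) v \<in> edges G \<and> v \<in> ends G ((q(x := e)) v)" if "v \<in> verts G" for v
    using qe[of v] that x e by auto
  ultimately have "\<exists>xs es. is_cycle G xs es"
    using is_cycle_if_inj_choice[of "q(x := e)"] xV by blast
  then show False using tree by (auto simp: is_tree_def)
qed

text \<open>Induction on the depth under \<open>p\<close>. Since \<open>q\<close> is onto, one end
  of the edge \<open>p v\<close> chooses it under \<open>q\<close>. If that were the parent
  \<open>w\<close>, the induction hypothesis would give \<open>p w = p v\<close>, against
  injectivity of \<open>p\<close>.\<close>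

lemma (in multigraph) arborescence_unique:
  assumes p: "arborescence G u p" and q: "arborescence G u q"
    and p_onto: "edges G = p ` (verts G - {u})" and q_onto: "edges G = q ` (verts G - {u})"
    and v: "v \<in> verts G - {u}"
  shows "p v = q v"
proof -
  obtain n where "depth (ends G) p u v n" using p v by (auto simp: arborescence_def)
  then show ?thesis using v
  proof (induction rule: depth.induct)
    case root
    then show ?case by simp
  next
    case (step v w n)
    have "p v \<in> edges G" using p_onto step.prems by blast
    then obtain x where x: "x \<in> verts G - {u}" "p v = q x" using q_onto by blast
    then have "x \<in> ends G (p v)" using q by (auto simp: arborescence_def)
    then consider "x = v" | "x = w" using step.hyps by auto
    then show ?case
    proof cases
      case 2
      then have "p x = p v" using step.IH x by simp
      then have "x = v" using inj_onD[OF arborescence_inj_on[OF p]] x(1) step.prems by blast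
      then show ?thesis using x by simp
    qed (use x in simp)
  qed
qed

section \<open>Choice functions and the trees they grow\<close>

text \<open>The functions are extensional, so that they can be counted by their values on
  \<open>A\<close>. The set \<open>A\<close> is a parameter because the root makes no choice in
  \<open>G\<close>, whereas in \<open>G - V(T)\<close> every vertex does.\<close>

definition edge_choices :: "('v, 'e) mgraph \<Rightarrow> 'v set \<Rightarrow> ('v \<Rightarrow> 'e) set" where
  "edge_choices G A = (\<Pi>\<^sub>E v\<in>A. {e \<in> edges G. v \<in> ends G e})"

definition basin :: "('v, 'e) mgraph \<Rightarrow> 'v \<Rightarrow> ('v \<Rightarrow> 'e) \<Rightarrow> 'v set" where
  "basin G u f = {v \<in> verts G. \<exists>n. depth (ends G) f u v n}"

definition chosen_tree :: "('v, 'e) mgraph \<Rightarrow> 'v \<Rightarrow> ('v \<Rightarrow> 'e) \<Rightarrow> ('v, 'e) mgraph" where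
  "chosen_tree G u f =
     \<lparr>verts = basin G u f, edges = f ` (basin G u f - {u}), ends = ends G\<rparr>"

text \<open>Allowing all vertices as well puts spanning and non-spanning trees on the same footing:
  each is the chosen tree of some choice functions.\<close>

definition rooted_subtrees :: "('v, 'e) mgraph \<Rightarrow> 'v \<Rightarrow> ('v, 'e) mgraph set" where
  "rooted_subtrees G u = {T. is_subgraph T G \<and> is_tree T \<and> u \<in> verts T}"

lemma card_edge_choices:
  assumes "finite A"
  shows "card (edge_choices G A) = (\<Prod>v\<in>A. graph_degree G v)"
  using assms by (simp add: edge_choices_def card_PiE graph_degree_def)

text \<open>No chosen edge crosses the boundary of the basin: the path from \<open>v\<close> to
  \<open>u\<close>, if there is one, continues through \<open>w\<close>.\<close>

lemma (in multigraph) basin_step_iff: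
  assumes "v \<in> verts G - {u}" and "f v \<in> edges G" and "ends G (f v) = {v, w}"
  shows "v \<in> basin G u f \<longleftrightarrow> w \<in> basin G u f"
proof
  assume "v \<in> basin G u f"
  then obtain n where "depth (ends G) f u v n" by (auto simp: basin_def)
  then obtain m where "depth (ends G) f u w m"
    using depth_parent[of "ends G" f u v n w] assms by blast
  then show "w \<in> basin G u f" using ends_in_verts[OF assms(2)] assms(3) by (auto simp: basin_def)
next
  assume "w \<in> basin G u f"
  then show "v \<in> basin G u f"
    using assms depth.step[of v u "ends G" f w] by (auto simp: basin_def)
qed

text \<open>The basin is closed under following \<open>f\<close>, so it forms a subgraph with its
  chosen edges. There \<open>f\<close> leads every vertex to \<open>u\<close> and chooses every
  edge, so \<open>arborescence_is_tree\<close> applies.\<close>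

lemma (in multigraph)
  assumes u: "u \<in> verts G" and f: "f \<in> edge_choices G (verts G - {u})"
  shows multigraph_chosen_tree: "multigraph (chosen_tree G u f)"
    and arborescence_chosen_tree: "arborescence (chosen_tree G u f) u f"
    and chosen_tree_rooted_subtree: "chosen_tree G u f \<in> rooted_subtrees G u"
proof -
  have sub: "basin G u f \<subseteq> verts G" by (auto simp: basin_def)
  have fv: "f v \<in> edges G" "v \<in> ends G (f v)" if "v \<in> verts G - {u}" for v
    using f that unfolding edge_choices_def by (auto dest: PiE_mem)
  have edges: "f ` (basin G u f - {u}) \<subseteq> edges G" using sub fv by blast
  have closed: "ends G (f v) \<subseteq> basin G u f" if v: "v \<in> basin G u f - {u}" for v
  proof -
    have vV: "v \<in> verts G - {u}" using v sub by blast
    obtain w where "ends G (f v) = {v, w}" using other_end[OF fv[OF vV]] by blast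
    then show ?thesis using basin_step_iff[of v u f w] vV fv(1)[OF vV] v by auto
  qed
  show mg: "multigraph (chosen_tree G u f)"
    using finite_subset[OF sub finite_verts] finite_subset[OF edges finite_edges] closed
      edges loopless
    by unfold_locales (auto simp: chosen_tree_def)
  have "u \<in> basin G u f" unfolding basin_def using u depth.root by fast
  then show arb: "arborescence (chosen_tree G u f) u f"
    using fv sub by (auto simp: arborescence_def chosen_tree_def basin_def)
  have "is_tree (chosen_tree G u f)"
    by (rule multigraph.arborescence_is_tree[OF mg arb]) (simp add: chosen_tree_def)
  moreover have "is_subgraph (chosen_tree G u f) G"
    using mg sub edges by (simp add: is_subgraph_def chosen_tree_def)
  ultimately show "chosen_tree G u f \<in> rooted_subtrees G u"
    using arb by (simp add: rooted_subtrees_def arborescence_def)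
qed

text \<open>A vertex outside the basin that chose an edge into it would reach \<open>u\<close> and
  belong to it.\<close>

lemma (in multigraph) restrict_edge_choices:
  assumes f: "f \<in> edge_choices G (verts G - {u})" and uW: "u \<in> W" and W: "W = basin G u f"
  shows "restrict f (verts G - W) \<in> edge_choices (delete_verts G W) (verts G - W)"
proof -
  have "f v \<in> edges G \<and> v \<in> ends G (f v) \<and> ends G (f v) \<subseteq> verts G - W"
    if v: "v \<in> verts G - W" for v
  proof -
    have vV: "v \<in> verts G - {u}" using v uW by auto
    then have fv: "f v \<in> edges G" "v \<in> ends G (f v)"
      using f unfolding edge_choices_def by (auto dest: PiE_mem)
    obtain w where "ends G (f v) = {v, w}" "w \<in> verts G" using other_end[OF fv] by blast
    then show ?thesis using basin_step_iff[of v u f w] vV v W fv by auto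
  qed
  then show ?thesis by (auto simp: edge_choices_def delete_verts_def)
qed

text \<open>Vertices of \<open>T\<close> reach \<open>u\<close> along \<open>p\<close>, while the
  edges chosen by \<open>g\<close> avoid \<open>T\<close>, so no other vertex does. The basin is
  thus the vertex set of \<open>T\<close>, and by \<open>arborescence_onto\<close> the chosen edges
  in it are all edges of \<open>T\<close>.\<close>

lemma (in multigraph) chosen_tree_combine:
  assumes T: "T \<in> rooted_subtrees G u" and p: "arborescence T u p"
    and g: "g \<in> edge_choices (delete_verts G (verts T)) (verts G - verts T)"
  defines "f \<equiv> \<lambda>v. if v \<in> verts T - {u} then p v else g v"
  shows "f \<in> edge_choices G (verts G - {u})" and "chosen_tree G u f = T"
proof -
  have sub: "verts T \<subseteq> verts G" "edges T \<subseteq> edges G" "ends T = ends G" "multigraph T"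
    and tree: "is_tree T" and u: "u \<in> verts T"
    using T by (auto simp: rooted_subtrees_def is_subgraph_def)
  interpret T: multigraph T by (fact sub)
  have gv: "g v \<in> edges G" "v \<in> ends G (g v)" "ends G (g v) \<subseteq> verts G - verts T"
    if "v \<in> verts G - verts T" for v
    using PiE_mem[OF g[unfolded edge_choices_def] that] by (auto simp: delete_verts_def)
  have pv: "p v \<in> edges T" "v \<in> ends G (p v)" if "v \<in> verts T - {u}" for v
    using p that sub by (auto simp: arborescence_def)
  \<comment> \<open>Needed also at \<open>u\<close>: there \<open>f\<close> takes the value of
    \<open>g\<close>, which is \<open>undefined\<close> because \<open>u\<close> lies in
    \<open>T\<close>, as extensionality of \<open>f\<close> demands.\<close>
  have g_out: "g v = undefined" if "v \<notin> verts G - verts T" for v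
    using PiE_arb[OF g[unfolded edge_choices_def] that] .
  show "f \<in> edge_choices G (verts G - {u})"
    unfolding edge_choices_def
  proof (rule PiE_I)
    fix v assume "v \<in> verts G - {u}"
    then show "f v \<in> {e \<in> edges G. v \<in> ends G e}"
      using gv[of v] pv[of v] sub(2) by (auto simp: f_def)
  next
    fix v assume "v \<notin> verts G - {u}"
    then show "f v = undefined" using g_out[of v] sub(1) u by (auto simp: f_def)
  qed
  have "v \<in> basin G u f" if v: "v \<in> verts T" for v
  proof -
    obtain n where n: "depth (ends G) p u v n"
      using p v sub by (auto simp: arborescence_def)
    have "depth (ends G) f u v n"
      using n v
    proof (rule depth_cong)
      fix x y assume "x \<in> verts T - {u}" "ends G (p x) = {x, y}"
      then show "y \<in> verts T" using T.ends_in_verts[OF pv(1), of x] sub by auto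
    qed (simp add: f_def)
    then show ?thesis using v sub by (auto simp: basin_def)
  qed
  moreover have "v \<in> verts T" if "depth (ends G) f u v n" "v \<in> verts G" for v n
    using that
  proof (induction rule: depth.induct)
    case root
    show ?case by (fact u)
  next
    case (step v w n)
    show ?case
    proof (rule ccontr)
      assume v: "v \<notin> verts T"
      then have "w \<in> verts G - verts T"
        using gv(3)[of v] step by (auto simp: f_def)
      then show False using step.IH by blast
    qed
  qed
  ultimately have basin: "basin G u f = verts T" by (auto simp: basin_def)
  have "f ` (verts T - {u}) = p ` (verts T - {u})" by (auto simp: f_def)
  then have "f ` (verts T - {u}) = edges T" using T.arborescence_onto[OF tree p] by simp
  then show "chosen_tree G u f = T"
    using basin sub(3) by (simp add: chosen_tree_def)
qed

section \<open>Counting choice functions by their chosen tree\<close>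

lemma (in multigraph) card_chosen_tree_fibre:
  assumes u: "u \<in> verts G" and T: "T \<in> rooted_subtrees G u"
  shows "card {f \<in> edge_choices G (verts G - {u}). chosen_tree G u f = T} =
    (\<Prod>v\<in>verts G - verts T. graph_degree (delete_verts G (verts T)) v)" (is "card ?F = _")
proof -
  let ?R = "\<lambda>f. restrict f (verts G - verts T)"
  let ?C = "edge_choices (delete_verts G (verts T)) (verts G - verts T)"
  have uT: "u \<in> verts T" and tree: "is_tree T" and mg: "multigraph T"
    using T by (auto simp: rooted_subtrees_def is_subgraph_def)
  interpret T: multigraph T by (fact mg)
  have F: "f \<in> edge_choices G (verts G - {u})" "verts T = basin G u f" "arborescence T u f"
    if "f \<in> ?F" for f
    using that arborescence_chosen_tree[OF u] by (auto simp: chosen_tree_def)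
  \<comment> \<open>On \<open>T\<close> both functions are the unique orientation towards
    \<open>u\<close>, so only their values outside \<open>T\<close> can differ.\<close>
  have "inj_on ?R ?F"
  proof (rule inj_onI)
    fix f g assume f: "f \<in> ?F" and g: "g \<in> ?F" and eq: "?R f = ?R g"
    show "f = g"
    proof (rule PiE_ext)
      show "f \<in> (\<Pi>\<^sub>E v\<in>verts G - {u}. {e \<in> edges G. v \<in> ends G e})"
        "g \<in> (\<Pi>\<^sub>E v\<in>verts G - {u}. {e \<in> edges G. v \<in> ends G e})"
        using F(1)[OF f] F(1)[OF g] by (simp_all add: edge_choices_def)
    next
      fix v assume v: "v \<in> verts G - {u}"
      show "f v = g v"
      proof (cases "v \<in> verts T")
        case True
        then show ?thesis
          using T.arborescence_unique[OF F(3)[OF f] F(3)[OF g]] v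
            T.arborescence_onto[OF tree F(3)[OF f]] T.arborescence_onto[OF tree F(3)[OF g]]
          by blast
      next
        case False
        then show ?thesis using fun_cong[OF eq, of v] v by simp
      qed
    qed
  qed
  moreover have "?R ` ?F \<subseteq> ?C"
    using restrict_edge_choices[OF F(1) uT F(2)] by blast
  moreover have "?C \<subseteq> ?R ` ?F"
  proof
    fix g assume g: "g \<in> ?C"
    obtain p where p: "arborescence T u p"
      using T.arborescence_exists[OF _ uT] tree by (auto simp: is_tree_def)
    let ?f = "\<lambda>v. if v \<in> verts T - {u} then p v else g v"
    have "?f \<in> ?F" using chosen_tree_combine[OF T p g] by blast
    moreover have "?R ?f = g"
    proof
      fix v show "?R ?f v = g v"
        using PiE_arb[OF g[unfolded edge_choices_def], of v] by auto
    qed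
    ultimately show "g \<in> ?R ` ?F" by (metis (no_types, lifting) image_eqI)
  qed
  ultimately have "bij_betw ?R ?F ?C" by (auto simp: bij_betw_def)
  then have "card ?F = card ?C" by (rule bij_betw_same_card)
  then show ?thesis by (simp add: card_edge_choices finite_verts)
qed

text \<open>Spanning trees are edge sets, subtrees are graphs. A subgraph keeps the incidence
  function, so one on all vertices is \<open>G\<close> with another edge set.\<close>

lemma (in multigraph) rooted_subtrees_split:
  assumes u: "u \<in> verts G"
  shows "rooted_subtrees G u = NST G u \<union> (\<lambda>F. G\<lparr>edges := F\<rparr>) ` spanning_trees G"
proof -
  have "T \<in> (\<lambda>F. G\<lparr>edges := F\<rparr>) ` spanning_trees G"
    if T: "T \<in> rooted_subtrees G u" "verts T = verts G" for T
  proof (rule image_eqI)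
    show eq: "T = G\<lparr>edges := edges T\<rparr>"
      using T by (simp add: rooted_subtrees_def is_subgraph_def)
    have "is_tree (G\<lparr>edges := edges T\<rparr>)"
      using T(1) unfolding eq[symmetric] by (simp add: rooted_subtrees_def)
    then show "edges T \<in> spanning_trees G"
      using T(1) by (simp add: rooted_subtrees_def is_subgraph_def spanning_trees_def)
  qed
  moreover have "G\<lparr>edges := F\<rparr> \<in> rooted_subtrees G u" if "F \<in> spanning_trees G" for F
    using that u
    by (auto simp: spanning_trees_def rooted_subtrees_def is_subgraph_def is_tree_def)
  ultimately show ?thesis by (auto simp: NST_def rooted_subtrees_def)
qed

theorem theorem2:
  fixes G :: "('v, 'e) mgraph" and u :: 'v
  assumes "multigraph G" and "u \<in> verts G"
  shows "int (num_spanning_trees G) =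
    (\<Prod>v\<in>verts G - {u}. int (graph_degree G v)) -
    (\<Sum>T\<in>NST G u. \<Prod>v\<in>verts G - verts T. int (graph_degree (delete_verts G (verts T)) v))"
proof -
  interpret multigraph G by (fact assms)
  note u = assms(2)
  let ?S = "(\<lambda>F. G\<lparr>edges := F\<rparr>) ` spanning_trees G"
  let ?w = "\<lambda>T. \<Prod>v\<in>verts G - verts T. graph_degree (delete_verts G (verts T)) v"
  let ?C = "edge_choices G (verts G - {u})"
  have fin: "finite (rooted_subtrees G u)"
    using rooted_subtrees_split[OF u] finite_NST finite_spanning_trees by simp
  have "finite ?C"
    unfolding edge_choices_def using finite_verts finite_edges by (intro finite_PiE) auto
  then have "card ?C = (\<Sum>T\<in>rooted_subtrees G u. card {f \<in> ?C. chosen_tree G u f = T})"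
    using sum.group[OF _ fin, of ?C "chosen_tree G u" "\<lambda>_. 1::nat"]
      chosen_tree_rooted_subtree[OF u] by (simp add: image_subset_iff)
  also have "\<dots> = (\<Sum>T\<in>rooted_subtrees G u. ?w T)"
    using card_chosen_tree_fibre[OF u] by simp
  also have "\<dots> = (\<Sum>T\<in>NST G u. ?w T) + (\<Sum>T\<in>?S. ?w T)"
    unfolding rooted_subtrees_split[OF u]
    by (rule sum.union_disjoint) (use finite_NST finite_spanning_trees in \<open>auto simp: NST_def\<close>)
  \<comment> \<open>A spanning tree leaves no vertex outside, so its weight is an empty
    product.\<close>
  also have "(\<Sum>T\<in>?S. ?w T) = (\<Sum>T\<in>?S. 1)" by (rule sum.cong) auto
  also have "\<dots> = card ?S" by simp
  also have "card ?S = num_spanning_trees G"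
    unfolding num_spanning_trees_def
    by (rule card_image) (auto simp: inj_on_def dest: arg_cong[where f = edges])
  \<comment> \<open>Over the naturals the identity is kept additive; the subtraction takes place
    only among integers.\<close>
  finally have "(\<Prod>v\<in>verts G - {u}. graph_degree G v) =
      (\<Sum>T\<in>NST G u. ?w T) + num_spanning_trees G"
    by (simp add: card_edge_choices finite_verts)
  then have "int (\<Prod>v\<in>verts G - {u}. graph_degree G v) =
      int (\<Sum>T\<in>NST G u. ?w T) + int (num_spanning_trees G)"
    by simp
  then show ?thesis by simp
qed

end
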